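(* Let $A\in\{A^{\mathrm{helm}},A^{\mathrm{mw}}\}$ be the operator of the acoustic or electromagnetic waveguide problem on $\Omega=D\times(0,L)$ defined in the context, let $k\in\mathbb R$, and let $$\tilde A\tilde u:=e^{\mathrm ikz}A(e^{-\mathrm ikz}\tilde u),\qquad D(\tilde A)=\{\tilde u: e^{-\mathrm ikz}\tilde u\in D(A)\},$$ where $z$ is the longitudinal variable. Then $\tilde A$ is bounded below if and only if $A$ is bounded below, and the boundedness below constants are identical: for every $\alpha>0$, $$\|Au\|\ge\alpha\|u\|\ \ \forall u\in D(A)\quad\Longleftrightarrow\quad\|\tilde A\tilde u\|\ge\alpha\|\tilde u\|\ \ \forall\tilde u\in D(\tilde A),$$ where $\|\cdot\|$ is the $L^2(\Omega)$ norm.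
   Context: $D\subset\mathbb R^d$ is a bounded Lipschitz domain with piecewise smooth boundary, $L>0$, $\omega>0$; points of $\Omega=D\times(0,L)$ are $(x,z)$; $\Gamma_{\rm in}=D\times\{0\}$, $\Gamma_{\rm lat}=\partial D\times(0,L)$, $\Gamma_{\rm out}=D\times\{L\}$ (identified with $D$); $\boldsymbol n$ is the outer normal. Functions are complex valued. Square roots are principal branches. Acoustic operator ($d\ge1$): $\mathfrak a=\operatorname{diag}(a(x),1)$ with $a:D\to\mathbb R^{d\times d}$ pointwise symmetric positive definite, uniformly bounded above and below. $(\lambda_n^N,\varphi_n)_{n}$ are the eigenpairs of $-\operatorname{div}(a\nabla\cdot)$ on $D$ with $\boldsymbol n\cdot a\nabla\varphi_n=0$ on $\partial D$, $L^2(D)$-orthonormal; $\kappa_n=\sqrt{\lambda^N_n-\omega^2}$, assumed nonzero for all $n$; $\mathrm{DtN}\,p=-\sum_n\kappa_n(p,\varphi_n)_{L^2(D)}\varphi_n$, a bounded map $H^{1/2}(\Gamma_{\rm out})\to\widetilde H^{-1/2}(\Gamma_{\rm out})=(H^{1/2}(\Gamma_{\rm out}))'$. $A^{\mathrm{helm}}(p,\boldsymbol u)=(\mathrm i\omega\boldsymbol u+\mathfrak a\nabla p,\ \mathrm i\omega p+\operatorname{div}\boldsymbol u)$ with domain $\{(p,\boldsymbol u)\in H^1(\Omega)\times\boldsymbol H(\operatorname{div},\Omega):p|_{\Gamma_{\rm in}}=0,\ \boldsymbol u\cdot\boldsymbol n=0\text{ in }H^{-1/2}(\Gamma_{\rm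 lat}),\ \mathrm i\omega\boldsymbol u\cdot\boldsymbol n+\mathrm{DtN}\,p=0\text{ in }\widetilde H^{-1/2}(\Gamma_{\rm out})\}$, where $H^{-1/2}(\Gamma_{\rm lat})$ is the dual of $\widetilde H^{1/2}(\Gamma_{\rm lat})$. Electromagnetic operator ($d=2$): $\Gamma_-=\partial\Omega\setminus\overline{\Gamma_{\rm out}}$, $\gamma_t\boldsymbol E=\boldsymbol E\times\boldsymbol n$, $\pi_t\boldsymbol E=\boldsymbol n\times(\boldsymbol E\times\boldsymbol n)$, $\boldsymbol H_{0,\Gamma_-}(\operatorname{curl},\Omega)=\{\boldsymbol E\in\boldsymbol H(\operatorname{curl},\Omega):\gamma_t\boldsymbol E=0\text{ on }\Gamma_-\}$. $(\lambda_j,\phi_j)_{j\ge1}$, $(\mu_i,\psi_i)_{i\ge0}$ ($\mu_0=0$) are the Dirichlet and Neumann eigenpairs of $-\Delta$ on $D$, real, orthogonal, normalized for $i,j\ge1$ by $\|\nabla\psi_i\|=\|\nabla\phi_j\|=1$; assume $\lambda_j\neq\omega^2$, $\mu_i\ne\omega^2$; $\widetilde\mu_i=\sqrt{\mu_i-\omega^2}$, $\widetilde\lambda_j=\sqrt{\lambda_j-\omega^2}$; $\nabla\times\psi=(\partial_2\psi,-\partial_1\psi)^\top$ for scalar $\psi$ on $D$. $\hat\alpha_i,\hat\beta_j$ are the continuous extensions to $\boldsymbol H_{0,\Gamma_-}(\operatorname{curl},\Omega)$ of $\boldsymbol E\mapsto(\pi_t\boldsymbol E,\nabla\times\psi_i)_{L^2(\Gamma_{\rm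 out})}$ and $\boldsymbol E\mapsto(\pi_t\boldsymbol E,\nabla\phi_j)_{L^2(\Gamma_{\rm out})}$. $\mathrm{DtN}^{\mathrm{mw}}\boldsymbol E=\sum_{i\ge1}-\frac{\widetilde\mu_i}{\mathrm i\omega}\hat\alpha_i(\boldsymbol E)\nabla\psi_i+\sum_{j\ge1}\frac{\mathrm i\omega}{\widetilde\lambda_j}\hat\beta_j(\boldsymbol E)\nabla\times\phi_j$, an element of the dual of $\gamma_t(\boldsymbol H_{0,\Gamma_-}(\operatorname{curl},\Omega))$. $A^{\mathrm{mw}}(\boldsymbol E,\boldsymbol H)=(\nabla\times\boldsymbol E-\mathrm i\omega\boldsymbol H,\ \nabla\times\boldsymbol H+\mathrm i\omega\boldsymbol E)$ with domain $\{(\boldsymbol E,\boldsymbol H)\in\boldsymbol H_{0,\Gamma_-}(\operatorname{curl},\Omega)\times\boldsymbol H(\operatorname{curl},\Omega):\pi_t\boldsymbol H=\mathrm{DtN}^{\mathrm{mw}}\boldsymbol E\text{ on }\Gamma_{\rm out}\}$. *)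

theory Defs
  imports "HOL-Analysis.Analysis"
begin

text \<open>
  Fields on \<open>\<Omega> = D \<times> (0, L)\<close> are functions on the type \<open>(real^'d) \<times> real\<close> of pairs \<open>(x, z)\<close>; vector
  fields take values in \<open>(complex^'d) \<times> complex\<close> (transversal and longitudinal components).
  Elements of $L^2$ and of the Sobolev spaces are represented by total functions, of which only the
  values on the domain matter; every notion below is invariant under changes on null sets.
  All pairings (inner products and dualities) are antilinear in the second argument.
\<close>


subsection \<open>Complex scalars on tuples of complex numbers\<close>

class complex_tuple = real_inner +
  fixes cscale :: "complex \<Rightarrow> 'a \<Rightarrow> 'a" (infixr "*\<^sub>C" 75)
    and cinner :: "'a \<Rightarrow> 'a \<Rightarrow> complex"
  assumes cscale_add_right: "c *\<^sub>C (x + y) = c *\<^sub>C x + c *\<^sub>C y"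
    and cscale_add_left: "(c + d) *\<^sub>C x = c *\<^sub>C x + d *\<^sub>C x"
    and cscale_cscale: "c *\<^sub>C d *\<^sub>C x = (c * d) *\<^sub>C x"
    and cscale_of_real: "complex_of_real r *\<^sub>C x = r *\<^sub>R x"
    and cinner_add_left: "cinner (x + y) w = cinner x w + cinner y w"
    and cinner_cscale_left: "cinner (c *\<^sub>C x) y = c * cinner x y"
    and cinner_commute: "cinner x y = cnj (cinner y x)"
    and Re_cinner: "Re (cinner x y) = inner x y"

instantiation complex :: complex_tuple
begin
definition "cscale c (x :: complex) = c * x"
definition "cinner (x :: complex) y = x * cnj y"
instance
  by standard
    (auto simp: cscale_complex_def cinner_complex_def algebra_simps scaleR_conv_of_real
      inner_complex_def)
end

instantiation vec :: (complex_tuple, finite) complex_tuple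
begin
definition "cscale c (x :: 'a ^ 'b) = (\<chi> i. c *\<^sub>C (x $ i))"
definition "cinner (x :: 'a ^ 'b) y = (\<Sum>i\<in>UNIV. cinner (x $ i) (y $ i))"
instance
proof
  fix x y w :: "'a ^ 'b" and c d :: complex and r :: real
  show "c *\<^sub>C (x + y) = c *\<^sub>C x + c *\<^sub>C y" "(c + d) *\<^sub>C x = c *\<^sub>C x + d *\<^sub>C x"
    "c *\<^sub>C d *\<^sub>C x = (c * d) *\<^sub>C x" "complex_of_real r *\<^sub>C x = r *\<^sub>R x"
    by (simp_all add: vec_eq_iff cscale_vec_def cscale_add_right cscale_add_left cscale_cscale
        cscale_of_real)
  show "cinner (x + y) w = cinner x w + cinner y w" "cinner (c *\<^sub>C x) y = c * cinner x y"
    "Re (cinner x y) = inner x y"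
    by (simp_all add: cinner_vec_def cscale_vec_def cinner_add_left cinner_cscale_left Re_cinner
        sum.distrib sum_distrib_left inner_vec_def)
  show "cinner x y = cnj (cinner y x)"
    unfolding cinner_vec_def cnj_sum by (intro sum.cong refl cinner_commute)
qed
end

instantiation prod :: (complex_tuple, complex_tuple) complex_tuple
begin
definition "cscale c (x :: 'a \<times> 'b) = (c *\<^sub>C fst x, c *\<^sub>C snd x)"
definition "cinner (x :: 'a \<times> 'b) y = cinner (fst x) (fst y) + cinner (snd x) (snd y)"
instance
proof
  fix x y w :: "'a \<times> 'b" and c d :: complex and r :: real
  show "c *\<^sub>C (x + y) = c *\<^sub>C x + c *\<^sub>C y" "(c + d) *\<^sub>C x = c *\<^sub>C x + d *\<^sub>C x"
    "c *\<^sub>C d *\<^sub>C x = (c * d) *\<^sub>C x" "complex_of_real r *\<^sub>C x = r *\<^sub>R x"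
    by (simp_all add: prod_eq_iff cscale_prod_def cscale_add_right cscale_add_left cscale_cscale
        cscale_of_real)
  show "cinner (x + y) w = cinner x w + cinner y w" "cinner (c *\<^sub>C x) y = c * cinner x y"
    "Re (cinner x y) = inner x y"
    by (simp_all add: cinner_prod_def cscale_prod_def cinner_add_left cinner_cscale_left Re_cinner
        inner_prod_def algebra_simps)
  show "cinner x y = cnj (cinner y x)"
    unfolding cinner_prod_def complex_cnj_add by (metis cinner_commute)
qed
end

lemma norm_cscale:
  fixes x :: "'a::complex_tuple"
  shows "norm (c *\<^sub>C x) = cmod c * norm x"
proof -
  have "cinner (c *\<^sub>C x) (c *\<^sub>C x) = c * (cnj c * cinner x x)"
    by (metis cinner_cscale_left cinner_commute complex_cnj_mult complex_cnj_cnj)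
  also have "\<dots> = complex_of_real ((cmod c)\<^sup>2) * cinner x x"
    by (metis complex_norm_square mult.assoc)
  finally have "Re (cinner (c *\<^sub>C x) (c *\<^sub>C x)) = (cmod c)\<^sup>2 * Re (cinner x x)"
    by simp
  then have "(norm (c *\<^sub>C x))\<^sup>2 = (cmod c * norm x)\<^sup>2"
    by (simp add: Re_cinner power2_norm_eq_inner power_mult_distrib)
  then show ?thesis
    by simp
qed


subsection \<open>Smooth functions\<close>

definition pd :: "'a::real_normed_vector \<Rightarrow> ('a \<Rightarrow> 'b::real_normed_vector) \<Rightarrow> 'a \<Rightarrow> 'b" where
  "pd b f x = frechet_derivative f (at x) b"

primrec iterated_pd :: "'a::real_normed_vector list \<Rightarrow> ('a \<Rightarrow> 'b::real_normed_vector) \<Rightarrow> 'a \<Rightarrow> 'b"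
  where
    "iterated_pd [] f = f"
  | "iterated_pd (b # bs) f = pd b (iterated_pd bs f)"

text \<open>$C^\infty$ on the whole space. The restrictions of these functions to a bounded domain \<open>U\<close> form
  $C^\infty(\overline U)$.\<close>

definition smooth :: "('a::real_normed_vector \<Rightarrow> 'b::real_normed_vector) \<Rightarrow> bool" where
  "smooth f \<longleftrightarrow> (\<forall>bs x. iterated_pd bs f differentiable (at x))"

definition test_function :: "'a::real_normed_vector set \<Rightarrow> ('a \<Rightarrow> 'b::real_normed_vector) \<Rightarrow> bool" where
  "test_function U f \<longleftrightarrow> smooth f \<and> compact (closure {x. f x \<noteq> 0}) \<and> closure {x. f x \<noteq> 0} \<subseteq> U"


subsection \<open>Bounded Lipschitz domains with piecewise smooth boundary\<close>

definition bounded_lipschitz_domain :: "'a::euclidean_space set \<Rightarrow> bool" where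
  "bounded_lipschitz_domain D \<longleftrightarrow>
    open D \<and> connected D \<and> D \<noteq> {} \<and> bounded D \<and>
    (\<forall>x\<in>frontier D. \<exists>U e g C. open U \<and> x \<in> U \<and> norm e = 1 \<and> C-lipschitz_on UNIV g \<and>
      D \<inter> U = {y \<in> U. y \<bullet> e > (g :: 'a \<Rightarrow> real) (y - (y \<bullet> e) *\<^sub>R e)})"

text \<open>Embedded smooth submanifolds of codimension \<open>m\<close> (possibly empty), as local regular zero sets.\<close>

definition smooth_submanifold :: "nat \<Rightarrow> 'a::euclidean_space set \<Rightarrow> bool" where
  "smooth_submanifold m S \<longleftrightarrow>
    (\<forall>x\<in>S. \<exists>U g. open U \<and> x \<in> U \<and> (\<forall>i<m. smooth (g i :: 'a \<Rightarrow> real)) \<and>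
      (\<forall>y\<in>U. \<forall>c. (\<forall>v. (\<Sum>i<m. c i * pd v (g i) y) = 0) \<longrightarrow> (\<forall>i<m. c i = 0)) \<and>
      S \<inter> U = {y \<in> U. \<forall>i<m. g i y = 0})"

text \<open>The boundary is a finite union of closed pieces, each smooth up to its edge; the pieces meet
  only along edges lying in finitely many smooth submanifolds of codimension 2.\<close>

definition piecewise_smooth_boundary :: "'a::euclidean_space set \<Rightarrow> bool" where
  "piecewise_smooth_boundary D \<longleftrightarrow>
    (\<exists>\<G> \<E>. finite \<G> \<and> finite \<E> \<and> pairwise disjnt \<G> \<and>
      (\<forall>G\<in>\<G>. openin (top_of_set (frontier D)) G \<and> connected G \<and>
        (\<exists>S. smooth_submanifold 1 S \<and> closure G \<subseteq> S)) \<and>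
      frontier D = (\<Union>G\<in>\<G>. closure G) \<and>
      (\<forall>S\<in>\<E>. smooth_submanifold 2 S) \<and> frontier D - \<Union>\<G> \<subseteq> \<Union>\<E>)"


subsection \<open>Lebesgue and Sobolev spaces\<close>

definition L2 :: "'a::euclidean_space set \<Rightarrow> ('a \<Rightarrow> 'b::real_normed_vector) \<Rightarrow> bool" where
  "L2 U f \<longleftrightarrow> f \<in> borel_measurable (lebesgue_on U) \<and> integrable (lebesgue_on U) (\<lambda>x. (norm (f x))\<^sup>2)"

definition l2_norm :: "'a::euclidean_space set \<Rightarrow> ('a \<Rightarrow> 'b::real_normed_vector) \<Rightarrow> real" where
  "l2_norm U f = sqrt (LINT x|lebesgue_on U. (norm (f x))\<^sup>2)"

definition l2_inner ::
  "'a::euclidean_space set \<Rightarrow> ('a \<Rightarrow> 'b::complex_tuple) \<Rightarrow> ('a \<Rightarrow> 'b) \<Rightarrow> complex" where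
  "l2_inner U f g = (LINT x|lebesgue_on U. cinner (f x) (g x))"

definition has_weak_pd ::
  "'a::euclidean_space set \<Rightarrow> 'a \<Rightarrow> ('a \<Rightarrow> 'b::complex_tuple) \<Rightarrow> ('a \<Rightarrow> 'b) \<Rightarrow> bool" where
  "has_weak_pd U b f g \<longleftrightarrow> L2 U f \<and> L2 U g \<and>
    (\<forall>\<phi>. test_function U \<phi> \<longrightarrow> l2_inner U f (pd b \<phi>) = - l2_inner U g \<phi>)"

definition weak_pd ::
  "'a::euclidean_space set \<Rightarrow> 'a \<Rightarrow> ('a \<Rightarrow> 'b::complex_tuple) \<Rightarrow> 'a \<Rightarrow> 'b" where
  "weak_pd U b f = (SOME g. has_weak_pd U b f g)"

definition H1 :: "'a::euclidean_space set \<Rightarrow> ('a \<Rightarrow> 'b::complex_tuple) \<Rightarrow> bool" where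
  "H1 U f \<longleftrightarrow> L2 U f \<and> (\<forall>b\<in>Basis. \<exists>g. has_weak_pd U b f g)"

definition H1_limit ::
  "'a::euclidean_space set \<Rightarrow> (nat \<Rightarrow> 'a \<Rightarrow> 'b::complex_tuple) \<Rightarrow> ('a \<Rightarrow> 'b) \<Rightarrow> bool" where
  "H1_limit U \<Phi> f \<longleftrightarrow>
    (\<lambda>n. l2_norm U (\<lambda>x. \<Phi> n x - f x)) \<longlonglongrightarrow> 0 \<and>
    (\<forall>b\<in>Basis. (\<lambda>n. l2_norm U (\<lambda>x. pd b (\<Phi> n) x - weak_pd U b f x)) \<longlonglongrightarrow> 0)"

definition H10 :: "'a::euclidean_space set \<Rightarrow> ('a \<Rightarrow> 'b::complex_tuple) \<Rightarrow> bool" where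
  "H10 U f \<longleftrightarrow> H1 U f \<and> (\<exists>\<Phi>. (\<forall>n. test_function U (\<Phi> n)) \<and> H1_limit U \<Phi> f)"

definition wgrad_D ::
  "(real^'d) set \<Rightarrow> (real^'d \<Rightarrow> complex) \<Rightarrow> real^'d \<Rightarrow> complex^'d" where
  "wgrad_D D f x = (\<chi> i. weak_pd D (axis i 1) f x)"

definition grad ::
  "((real^'d) \<times> real \<Rightarrow> complex) \<Rightarrow> (real^'d) \<times> real \<Rightarrow> (complex^'d) \<times> complex" where
  "grad f y = ((\<chi> i. pd (axis i 1, 0) f y), pd (0, 1) f y)"

definition wgrad ::
  "((real^'d) \<times> real) set \<Rightarrow> ((real^'d) \<times> real \<Rightarrow> complex) \<Rightarrow>
    (real^'d) \<times> real \<Rightarrow> (complex^'d) \<times> complex" where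
  "wgrad U f y = ((\<chi> i. weak_pd U (axis i 1, 0) f y), weak_pd U (0, 1) f y)"

definition has_weak_div ::
  "((real^'d) \<times> real) set \<Rightarrow> ((real^'d) \<times> real \<Rightarrow> (complex^'d) \<times> complex) \<Rightarrow>
    ((real^'d) \<times> real \<Rightarrow> complex) \<Rightarrow> bool" where
  "has_weak_div U u g \<longleftrightarrow> L2 U u \<and> L2 U g \<and>
    (\<forall>\<phi>. test_function U \<phi> \<longrightarrow> l2_inner U u (grad \<phi>) = - l2_inner U g \<phi>)"

definition wdiv ::
  "((real^'d) \<times> real) set \<Rightarrow> ((real^'d) \<times> real \<Rightarrow> (complex^'d) \<times> complex) \<Rightarrow>
    (real^'d) \<times> real \<Rightarrow> complex" where
  "wdiv U u = (SOME g. has_weak_div U u g)"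

definition Hdiv ::
  "((real^'d) \<times> real) set \<Rightarrow> ((real^'d) \<times> real \<Rightarrow> (complex^'d) \<times> complex) \<Rightarrow> bool" where
  "Hdiv U u \<longleftrightarrow> (\<exists>g. has_weak_div U u g)"

definition curl ::
  "((real^2) \<times> real \<Rightarrow> (complex^2) \<times> complex) \<Rightarrow> (real^2) \<times> real \<Rightarrow> (complex^2) \<times> complex" where
  "curl F y =
    (let d1 = pd (axis 1 1, 0); d2 = pd (axis 2 1, 0); d3 = pd (0, 1);
         F1 = (\<lambda>y. fst (F y) $ 1); F2 = (\<lambda>y. fst (F y) $ 2); F3 = (\<lambda>y. snd (F y))
     in (vector [d2 F3 y - d3 F2 y, d3 F1 y - d1 F3 y], d1 F2 y - d2 F1 y))"

definition has_weak_curl ::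
  "((real^2) \<times> real) set \<Rightarrow> ((real^2) \<times> real \<Rightarrow> (complex^2) \<times> complex) \<Rightarrow>
    ((real^2) \<times> real \<Rightarrow> (complex^2) \<times> complex) \<Rightarrow> bool" where
  "has_weak_curl U E G \<longleftrightarrow> L2 U E \<and> L2 U G \<and>
    (\<forall>\<phi>. test_function U \<phi> \<longrightarrow> l2_inner U E (curl \<phi>) = l2_inner U G \<phi>)"

definition wcurl ::
  "((real^2) \<times> real) set \<Rightarrow> ((real^2) \<times> real \<Rightarrow> (complex^2) \<times> complex) \<Rightarrow>
    (real^2) \<times> real \<Rightarrow> (complex^2) \<times> complex" where
  "wcurl U E = (SOME G. has_weak_curl U E G)"

definition Hcurl ::
  "((real^2) \<times> real) set \<Rightarrow> ((real^2) \<times> real \<Rightarrow> (complex^2) \<times> complex) \<Rightarrow> bool" where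
  "Hcurl U E \<longleftrightarrow> (\<exists>G. has_weak_curl U E G)"

definition Hcurl_limit ::
  "((real^2) \<times> real) set \<Rightarrow> (nat \<Rightarrow> (real^2) \<times> real \<Rightarrow> (complex^2) \<times> complex) \<Rightarrow>
    ((real^2) \<times> real \<Rightarrow> (complex^2) \<times> complex) \<Rightarrow> bool" where
  "Hcurl_limit U \<Phi> E \<longleftrightarrow>
    (\<lambda>n. l2_norm U (\<lambda>y. \<Phi> n y - E y)) \<longlonglongrightarrow> 0 \<and>
    (\<lambda>n. l2_norm U (\<lambda>y. curl (\<Phi> n) y - wcurl U E y)) \<longlonglongrightarrow> 0"


subsection \<open>The waveguide and traces on its flat boundary parts\<close>

definition waveguide :: "(real^'d) set \<Rightarrow> real \<Rightarrow> ((real^'d) \<times> real) set" where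
  "waveguide D L = D \<times> {0<..<L}"

text \<open>Trace of an $H^1(\Omega)$ function on \<open>D \<times> {z0}\<close>, identified with \<open>D\<close>, for \<open>z0 = 0\<close>
  (inflow) and \<open>z0 = L\<close> (outflow): continuous extension of the restriction of
  $C^\infty(\overline\Omega)$ functions.\<close>

definition has_trace ::
  "(real^'d) set \<Rightarrow> real \<Rightarrow> real \<Rightarrow> ((real^'d) \<times> real \<Rightarrow> 'b::complex_tuple) \<Rightarrow>
    (real^'d \<Rightarrow> 'b) \<Rightarrow> bool" where
  "has_trace D L z0 p g \<longleftrightarrow> L2 D g \<and>
    (\<exists>\<Phi>. (\<forall>n. smooth (\<Phi> n)) \<and> H1_limit (waveguide D L) \<Phi> p \<and>
      (\<lambda>n. l2_norm D (\<lambda>x. \<Phi> n (x, z0) - g x)) \<longlonglongrightarrow> 0)"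

definition trace ::
  "(real^'d) set \<Rightarrow> real \<Rightarrow> real \<Rightarrow> ((real^'d) \<times> real \<Rightarrow> 'b::complex_tuple) \<Rightarrow> real^'d \<Rightarrow> 'b" where
  "trace D L z0 p = (SOME g. has_trace D L z0 p g)"


subsection \<open>Eigenpairs on the cross-section\<close>

definition cmat :: "real^'n^'m \<Rightarrow> complex^'n^'m" where
  "cmat M = (\<chi> i j. complex_of_real (M $ i $ j))"

text \<open>Weak eigenpairs of $-\mathrm{div}(a\nabla\cdot)$: the form domain \<open>V\<close> is $H^1(D)$ for the natural
  (Neumann) and $H^1_0(D)$ for the Dirichlet condition.\<close>

definition is_eigenpair ::
  "(real^'d) set \<Rightarrow> ((real^'d \<Rightarrow> complex) \<Rightarrow> bool) \<Rightarrow> (real^'d \<Rightarrow> real^'d^'d) \<Rightarrow>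
    real \<Rightarrow> (real^'d \<Rightarrow> complex) \<Rightarrow> bool" where
  "is_eigenpair D V a l \<phi> \<longleftrightarrow> V \<phi> \<and> l2_norm D \<phi> \<noteq> 0 \<and>
    (\<forall>v. V v \<longrightarrow>
      l2_inner D (\<lambda>x. cmat (a x) *v wgrad_D D \<phi> x) (wgrad_D D v) = complex_of_real l * l2_inner D \<phi> v)"

text \<open>An enumeration of the eigenpairs, counted with multiplicity: an $L^2$-orthogonal family of
  eigenfunctions which is maximal, i.e. no eigenfunction is orthogonal to all its members.\<close>

definition are_the_eigenpairs ::
  "(real^'d) set \<Rightarrow> ((real^'d \<Rightarrow> complex) \<Rightarrow> bool) \<Rightarrow> (real^'d \<Rightarrow> real^'d^'d) \<Rightarrow>
    nat set \<Rightarrow> (nat \<Rightarrow> real) \<Rightarrow> (nat \<Rightarrow> real^'d \<Rightarrow> complex) \<Rightarrow> bool" where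
  "are_the_eigenpairs D V a I lam \<phi> \<longleftrightarrow>
    (\<forall>n\<in>I. is_eigenpair D V a (lam n) (\<phi> n)) \<and>
    (\<forall>n\<in>I. \<forall>m\<in>I. n \<noteq> m \<longrightarrow> l2_inner D (\<phi> n) (\<phi> m) = 0) \<and>
    (\<forall>l v. is_eigenpair D V a l v \<longrightarrow> (\<exists>n\<in>I. l2_inner D v (\<phi> n) \<noteq> 0))"


subsection \<open>The acoustic operator\<close>

definition coefficient :: "(real^'d) set \<Rightarrow> (real^'d \<Rightarrow> real^'d^'d) \<Rightarrow> bool" where
  "coefficient D a \<longleftrightarrow> a \<in> borel_measurable (lebesgue_on D) \<and>
    (\<forall>x\<in>D. transpose (a x) = a x) \<and>
    (\<exists>c>0. \<exists>C. \<forall>x\<in>D. \<forall>\<xi>. c * (norm \<xi>)\<^sup>2 \<le> \<xi> \<bullet> (a x *v \<xi>) \<and> \<xi> \<bullet> (a x *v \<xi>) \<le> C * (norm \<xi>)\<^sup>2)"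

definition frak_a ::
  "(real^'d \<Rightarrow> real^'d^'d) \<Rightarrow> (real^'d) \<times> real \<Rightarrow> (complex^'d) \<times> complex \<Rightarrow> (complex^'d) \<times> complex" where
  "frak_a a y v = (cmat (a (fst y)) *v fst v, snd v)"

definition kappa :: "real \<Rightarrow> real \<Rightarrow> complex" where
  "kappa \<omega> l = csqrt (complex_of_real (l - \<omega>\<^sup>2))"

definition acoustic_setting ::
  "(real^'d) set \<Rightarrow> real \<Rightarrow> real \<Rightarrow> (real^'d \<Rightarrow> real^'d^'d) \<Rightarrow> (nat \<Rightarrow> real) \<Rightarrow>
    (nat \<Rightarrow> real^'d \<Rightarrow> complex) \<Rightarrow> bool" where
  "acoustic_setting D L \<omega> a lam \<phi> \<longleftrightarrow>
    bounded_lipschitz_domain D \<and> piecewise_smooth_boundary D \<and> L > 0 \<and> \<omega> > 0 \<and>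
    coefficient D a \<and>
    are_the_eigenpairs D (H1 D) a UNIV lam \<phi> \<and> (\<forall>n. l2_norm D (\<phi> n) = 1) \<and>
    (\<forall>n. kappa \<omega> (lam n) \<noteq> 0)"

text \<open>The functional $\mathrm{DtN}\,p \in (H^{1/2}(\Gamma_{\rm out}))'$, evaluated at \<open>q\<close>; here \<open>p\<close>, \<open>q\<close> are
  functions on $\Gamma_{\rm out} \simeq D$.\<close>

definition DtN_helm ::
  "(real^'d) set \<Rightarrow> real \<Rightarrow> (nat \<Rightarrow> real) \<Rightarrow> (nat \<Rightarrow> real^'d \<Rightarrow> complex) \<Rightarrow>
    (real^'d \<Rightarrow> complex) \<Rightarrow> (real^'d \<Rightarrow> complex) \<Rightarrow> complex" where
  "DtN_helm D \<omega> lam \<phi> p q =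
    - (\<Sum>\<^sub>\<infinity>n. kappa \<omega> (lam n) * l2_inner D p (\<phi> n) * l2_inner D (\<phi> n) q)"

text \<open>The normal trace $\boldsymbol u\cdot\boldsymbol n \in H^{-1/2}(\partial\Omega)$ of \<open>u\<close> in $H(\mathrm{div})$,
  evaluated at the boundary values of \<open>v\<close> in $H^1$.\<close>

definition normal_trace ::
  "((real^'d) \<times> real) set \<Rightarrow> ((real^'d) \<times> real \<Rightarrow> (complex^'d) \<times> complex) \<Rightarrow>
    ((real^'d) \<times> real \<Rightarrow> complex) \<Rightarrow> complex" where
  "normal_trace U u v = l2_inner U u (wgrad U v) + l2_inner U (wdiv U u) v"

text \<open>\<open>H1\<close>-functions with zero trace on the inflow and outflow boundaries are those whose boundary
  values lie in $\widetilde H^{1/2}(\Gamma_{\rm lat})$ (extended by zero).\<close>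

definition normal_trace_lat_zero ::
  "(real^'d) set \<Rightarrow> real \<Rightarrow> ((real^'d) \<times> real \<Rightarrow> (complex^'d) \<times> complex) \<Rightarrow> bool" where
  "normal_trace_lat_zero D L u \<longleftrightarrow>
    (\<forall>v. H1 (waveguide D L) v \<and> has_trace D L 0 v (\<lambda>_. 0) \<and> has_trace D L L v (\<lambda>_. 0) \<longrightarrow>
      normal_trace (waveguide D L) u v = 0)"

text \<open>If \<open>u\<close> has zero normal trace on $\Gamma_{\rm lat}$, then its normal trace on $\Gamma_{\rm out}$ acts on all
  \<open>q\<close> in $H^{1/2}(\Gamma_{\rm out})$, not only on those vanishing at the edge: the value at \<open>q\<close> is
  \<open>normal_trace \<Omega> u v\<close> for any \<open>v\<close> in $H^1(\Omega)$ with trace \<open>q\<close> on $\Gamma_{\rm out}$ and zero trace on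
  $\Gamma_{\rm in}$, whatever the boundary values of \<open>v\<close> on $\Gamma_{\rm lat}$.\<close>

definition dom_helm ::
  "(real^'d) set \<Rightarrow> real \<Rightarrow> real \<Rightarrow> (nat \<Rightarrow> real) \<Rightarrow> (nat \<Rightarrow> real^'d \<Rightarrow> complex) \<Rightarrow>
    ((real^'d) \<times> real \<Rightarrow> complex \<times> (complex^'d) \<times> complex) set" where
  "dom_helm D L \<omega> lam \<phi> = {w.
    let \<Omega> = waveguide D L; p = (\<lambda>y. fst (w y)); u = (\<lambda>y. snd (w y)) in
      H1 \<Omega> p \<and> Hdiv \<Omega> u \<and>
      has_trace D L 0 p (\<lambda>_. 0) \<and>
      normal_trace_lat_zero D L u \<and>
      (\<forall>v q. H1 \<Omega> v \<and> has_trace D L 0 v (\<lambda>_. 0) \<and> has_trace D L L v q \<longrightarrow>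
        \<i> * complex_of_real \<omega> * normal_trace \<Omega> u v + DtN_helm D \<omega> lam \<phi> (trace D L L p) q = 0)}"

definition A_helm ::
  "(real^'d) set \<Rightarrow> real \<Rightarrow> real \<Rightarrow> (real^'d \<Rightarrow> real^'d^'d) \<Rightarrow>
    ((real^'d) \<times> real \<Rightarrow> complex \<times> (complex^'d) \<times> complex) \<Rightarrow>
    (real^'d) \<times> real \<Rightarrow> ((complex^'d) \<times> complex) \<times> complex" where
  "A_helm D L \<omega> a w =
    (let \<Omega> = waveguide D L; p = (\<lambda>y. fst (w y)); u = (\<lambda>y. snd (w y)) in
      (\<lambda>y. ((\<i> * complex_of_real \<omega>) *\<^sub>C u y + frak_a a y (wgrad \<Omega> p y),
            \<i> * complex_of_real \<omega> * p y + wdiv \<Omega> u y)))"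


subsection \<open>The electromagnetic operator\<close>

definition curl_D :: "(real^2) set \<Rightarrow> (real^2 \<Rightarrow> complex) \<Rightarrow> real^2 \<Rightarrow> complex^2" where
  "curl_D D \<psi> x = vector [weak_pd D (axis 2 1) \<psi> x, - weak_pd D (axis 1 1) \<psi> x]"

definition maxwell_setting ::
  "(real^2) set \<Rightarrow> real \<Rightarrow> real \<Rightarrow> (nat \<Rightarrow> real) \<Rightarrow> (nat \<Rightarrow> real^2 \<Rightarrow> complex) \<Rightarrow>
    (nat \<Rightarrow> real) \<Rightarrow> (nat \<Rightarrow> real^2 \<Rightarrow> complex) \<Rightarrow> bool" where
  "maxwell_setting D L \<omega> lam \<phi> mu \<psi> \<longleftrightarrow>
    bounded_lipschitz_domain D \<and> piecewise_smooth_boundary D \<and> L > 0 \<and> \<omega> > 0 \<and>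
    are_the_eigenpairs D (H10 D) (\<lambda>_. mat 1) {1..} lam \<phi> \<and>
    are_the_eigenpairs D (H1 D) (\<lambda>_. mat 1) UNIV mu \<psi> \<and> mu 0 = 0 \<and>
    (\<forall>j\<ge>1. AE x in lebesgue_on D. \<phi> j x \<in> \<real>) \<and> (\<forall>i. AE x in lebesgue_on D. \<psi> i x \<in> \<real>) \<and>
    (\<forall>j\<ge>1. l2_norm D (wgrad_D D (\<phi> j)) = 1) \<and> (\<forall>i\<ge>1. l2_norm D (wgrad_D D (\<psi> i)) = 1) \<and>
    (\<forall>j\<ge>1. lam j \<noteq> \<omega>\<^sup>2) \<and> (\<forall>i. mu i \<noteq> \<omega>\<^sup>2)"

definition ccross ::
  "(complex^2) \<times> complex \<Rightarrow> (complex^2) \<times> complex \<Rightarrow> (complex^2) \<times> complex" where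
  "ccross v w =
    (vector [fst v $ 2 * snd w - snd v * fst w $ 2, snd v * fst w $ 1 - fst v $ 1 * snd w],
     fst v $ 1 * fst w $ 2 - fst v $ 2 * fst w $ 1)"

text \<open>Outer normal and tangential components on $\Gamma_{\rm out}$.\<close>

definition n_out :: "(complex^2) \<times> complex" where
  "n_out = (0, 1)"

definition gamma_t :: "(complex^2) \<times> complex \<Rightarrow> (complex^2) \<times> complex" where
  "gamma_t v = ccross v n_out"

definition pi_t :: "(complex^2) \<times> complex \<Rightarrow> (complex^2) \<times> complex" where
  "pi_t v = ccross n_out (ccross v n_out)"

text \<open>$\langle \pi_t \boldsymbol H, \gamma_t \boldsymbol F\rangle$ on $\partial\Omega$, by Green's formula: for smooth fields this is
  $\int_{\partial\Omega} \boldsymbol H\cdot(\overline{\boldsymbol F}\times\boldsymbol n)$.\<close>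

definition tangential_pairing ::
  "((real^2) \<times> real) set \<Rightarrow> ((real^2) \<times> real \<Rightarrow> (complex^2) \<times> complex) \<Rightarrow>
    ((real^2) \<times> real \<Rightarrow> (complex^2) \<times> complex) \<Rightarrow> complex" where
  "tangential_pairing U H F = l2_inner U (wcurl U H) F - l2_inner U H (wcurl U F)"

text \<open>$\gamma_t\boldsymbol E = 0$ on $\Gamma_-$, i.e. on the dual of those boundary values of $H^1(\Omega)$ fields \<open>F\<close> that
  are supported on $\Gamma_-$. Up to sign, \<open>tangential_pairing \<Omega> E F\<close> is the pairing of $\gamma_t\boldsymbol E$
  with the boundary values of \<open>F\<close>.\<close>

definition Hcurl0 ::
  "(real^2) set \<Rightarrow> real \<Rightarrow> ((real^2) \<times> real \<Rightarrow> (complex^2) \<times> complex) \<Rightarrow> bool" where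
  "Hcurl0 D L E \<longleftrightarrow> Hcurl (waveguide D L) E \<and>
    (\<forall>F. H1 (waveguide D L) F \<and> has_trace D L L F (\<lambda>_. 0) \<longrightarrow>
      tangential_pairing (waveguide D L) E F = 0)"

text \<open>Continuous extension to \<open>Hcurl0 D L\<close> of a functional given on its dense subspace of fields in
  $C^\infty(\overline\Omega)$.\<close>

definition continuous_ext ::
  "(real^2) set \<Rightarrow> real \<Rightarrow> (((real^2) \<times> real \<Rightarrow> (complex^2) \<times> complex) \<Rightarrow> complex) \<Rightarrow>
    ((real^2) \<times> real \<Rightarrow> (complex^2) \<times> complex) \<Rightarrow> complex" where
  "continuous_ext D L f E = (THE c. \<exists>\<Phi>. (\<forall>n. smooth (\<Phi> n) \<and> Hcurl0 D L (\<Phi> n)) \<and>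
    Hcurl_limit (waveguide D L) \<Phi> E \<and> (\<lambda>n. f (\<Phi> n)) \<longlonglongrightarrow> c)"

definition alpha_hat ::
  "(real^2) set \<Rightarrow> real \<Rightarrow> (real^2 \<Rightarrow> complex) \<Rightarrow> ((real^2) \<times> real \<Rightarrow> (complex^2) \<times> complex) \<Rightarrow> complex" where
  "alpha_hat D L \<psi> =
    continuous_ext D L (\<lambda>E. l2_inner D (\<lambda>x. pi_t (E (x, L))) (\<lambda>x. (curl_D D \<psi> x, 0)))"

definition beta_hat ::
  "(real^2) set \<Rightarrow> real \<Rightarrow> (real^2 \<Rightarrow> complex) \<Rightarrow> ((real^2) \<times> real \<Rightarrow> (complex^2) \<times> complex) \<Rightarrow> complex" where
  "beta_hat D L \<phi> =
    continuous_ext D L (\<lambda>E. l2_inner D (\<lambda>x. pi_t (E (x, L))) (\<lambda>x. (wgrad_D D \<phi> x, 0)))"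

text \<open>A tangential field \<open>t\<close> on $\Gamma_{\rm out}$ as a functional on the traces $\gamma_t \boldsymbol F$.\<close>

definition pairing_gamma_t ::
  "(real^2) set \<Rightarrow> real \<Rightarrow> (real^2 \<Rightarrow> complex^2) \<Rightarrow> ((real^2) \<times> real \<Rightarrow> (complex^2) \<times> complex) \<Rightarrow> complex" where
  "pairing_gamma_t D L t =
    continuous_ext D L (\<lambda>F. l2_inner D (\<lambda>x. (t x, 0)) (\<lambda>x. gamma_t (F (x, L))))"

text \<open>$\langle \mathrm{DtN}^{\mathrm{mw}}\boldsymbol E, \gamma_t \boldsymbol F\rangle$ on $\Gamma_{\rm out}$; note that
  \<open>kappa \<omega> l\<close> is $\sqrt{l-\omega^2}$.\<close>

definition DtN_mw ::
  "(real^2) set \<Rightarrow> real \<Rightarrow> real \<Rightarrow> (nat \<Rightarrow> real) \<Rightarrow> (nat \<Rightarrow> real^2 \<Rightarrow> complex) \<Rightarrow>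
    (nat \<Rightarrow> real) \<Rightarrow> (nat \<Rightarrow> real^2 \<Rightarrow> complex) \<Rightarrow>
    ((real^2) \<times> real \<Rightarrow> (complex^2) \<times> complex) \<Rightarrow>
    ((real^2) \<times> real \<Rightarrow> (complex^2) \<times> complex) \<Rightarrow> complex" where
  "DtN_mw D L \<omega> lam \<phi> mu \<psi> E F =
    (\<Sum>\<^sub>\<infinity>i\<in>{1..}. - (kappa \<omega> (mu i) / (\<i> * complex_of_real \<omega>)) * alpha_hat D L (\<psi> i) E *
        pairing_gamma_t D L (wgrad_D D (\<psi> i)) F) +
    (\<Sum>\<^sub>\<infinity>j\<in>{1..}. (\<i> * complex_of_real \<omega>) / kappa \<omega> (lam j) * beta_hat D L (\<phi> j) E *
        pairing_gamma_t D L (curl_D D (\<phi> j)) F)"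

definition dom_mw ::
  "(real^2) set \<Rightarrow> real \<Rightarrow> real \<Rightarrow> (nat \<Rightarrow> real) \<Rightarrow> (nat \<Rightarrow> real^2 \<Rightarrow> complex) \<Rightarrow>
    (nat \<Rightarrow> real) \<Rightarrow> (nat \<Rightarrow> real^2 \<Rightarrow> complex) \<Rightarrow>
    ((real^2) \<times> real \<Rightarrow> ((complex^2) \<times> complex) \<times> (complex^2) \<times> complex) set" where
  "dom_mw D L \<omega> lam \<phi> mu \<psi> = {w.
    let E = (\<lambda>y. fst (w y)); H = (\<lambda>y. snd (w y)) in
      Hcurl0 D L E \<and> Hcurl (waveguide D L) H \<and>
      (\<forall>F. Hcurl0 D L F \<longrightarrow>
        tangential_pairing (waveguide D L) H F = DtN_mw D L \<omega> lam \<phi> mu \<psi> E F)}"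

definition A_mw ::
  "(real^2) set \<Rightarrow> real \<Rightarrow> real \<Rightarrow>
    ((real^2) \<times> real \<Rightarrow> ((complex^2) \<times> complex) \<times> (complex^2) \<times> complex) \<Rightarrow>
    (real^2) \<times> real \<Rightarrow> ((complex^2) \<times> complex) \<times> (complex^2) \<times> complex" where
  "A_mw D L \<omega> w =
    (let \<Omega> = waveguide D L; E = (\<lambda>y. fst (w y)); H = (\<lambda>y. snd (w y)) in
      (\<lambda>y. (wcurl \<Omega> E y - (\<i> * complex_of_real \<omega>) *\<^sub>C H y,
            wcurl \<Omega> H y + (\<i> * complex_of_real \<omega>) *\<^sub>C E y)))"


subsection \<open>Conjugation by the longitudinal phase and boundedness below\<close>

definition phase ::
  "real \<Rightarrow> ('x \<times> real \<Rightarrow> 'v::complex_tuple) \<Rightarrow> 'x \<times> real \<Rightarrow> 'v" where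
  "phase k u y = exp (\<i> * complex_of_real (k * snd y)) *\<^sub>C u y"

definition tilde_dom ::
  "real \<Rightarrow> ('x \<times> real \<Rightarrow> 'v::complex_tuple) set \<Rightarrow> ('x \<times> real \<Rightarrow> 'v) set" where
  "tilde_dom k \<D> = {u. phase (- k) u \<in> \<D>}"

definition tilde_op ::
  "real \<Rightarrow> (('x \<times> real \<Rightarrow> 'v::complex_tuple) \<Rightarrow> 'x \<times> real \<Rightarrow> 'w::complex_tuple) \<Rightarrow>
    ('x \<times> real \<Rightarrow> 'v) \<Rightarrow> 'x \<times> real \<Rightarrow> 'w" where
  "tilde_op k A u = phase k (A (phase (- k) u))"

definition bounded_below_by ::
  "real \<Rightarrow> 'a::euclidean_space set \<Rightarrow> ('a \<Rightarrow> 'v::complex_tuple) set \<Rightarrow>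
    (('a \<Rightarrow> 'v) \<Rightarrow> 'a \<Rightarrow> 'w::complex_tuple) \<Rightarrow> bool" where
  "bounded_below_by \<alpha> U \<D> A \<longleftrightarrow> (\<forall>u\<in>\<D>. l2_norm U (A u) \<ge> \<alpha> * l2_norm U u)"

definition bounded_below ::
  "'a::euclidean_space set \<Rightarrow> ('a \<Rightarrow> 'v::complex_tuple) set \<Rightarrow>
    (('a \<Rightarrow> 'v) \<Rightarrow> 'a \<Rightarrow> 'w::complex_tuple) \<Rightarrow> bool" where
  "bounded_below U \<D> A \<longleftrightarrow> (\<exists>\<alpha>>0. bounded_below_by \<alpha> U \<D> A)"

end

theory Submission
  imports Defs
begin

text \<open>
  Multiplication by \<open>exp (i k z)\<close> preserves the pointwise norm, since \<open>k z\<close> is real, and is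
  invertible with inverse \<open>exp (- i k z)\<close>. It therefore carries \<open>\<D>\<close> bijectively onto \<open>tilde_dom k \<D>\<close>
  without changing the $L^2$ norms of a field or of its image. Hence conjugation by the phase
  preserves the boundedness below constants of every operator on every domain
  (\<open>bounded_below_by_tilde\<close>). The acoustic and the electromagnetic operator are two instances;
  differential operators and boundary conditions are conjugated as a whole.
\<close>

lemma phase_phase:
  "phase k (phase l u) = phase (k + l) u"
  by (rule ext) (simp add: phase_def cscale_cscale exp_add [symmetric] algebra_simps)

lemma phase_0: "phase 0 u = u"
  by (rule ext) (use cscale_of_real [of 1] in \<open>simp add: phase_def\<close>)

lemma phase_minus_cancel: "phase (- k) (phase k u) = u"
  by (simp add: phase_phase phase_0)

lemma norm_phase: "norm (phase k u y) = norm (u y)"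
  by (simp add: phase_def norm_cscale)

lemma l2_norm_phase: "l2_norm U (phase k u) = l2_norm U u"
  by (simp add: l2_norm_def norm_phase)

lemma tilde_dom_eq_image: "tilde_dom k \<D> = phase k ` \<D>"
proof
  show "phase k ` \<D> \<subseteq> tilde_dom k \<D>"
    by (auto simp: tilde_dom_def phase_minus_cancel)
  show "tilde_dom k \<D> \<subseteq> phase k ` \<D>"
  proof
    fix u assume "u \<in> tilde_dom k \<D>"
    then have "phase (- k) u \<in> \<D>"
      by (simp add: tilde_dom_def)
    moreover have "u = phase k (phase (- k) u)"
      by (simp add: phase_phase phase_0)
    ultimately show "u \<in> phase k ` \<D>"
      by blast
  qed
qed

text \<open>Substituting \<open>phase k u\<close> for the field turns each estimate for the conjugated operator into the
  estimate for \<open>u\<close>, because the phases drop out of both norms.\<close>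

lemma bounded_below_by_tilde:
  "bounded_below_by \<alpha> U (tilde_dom k \<D>) (tilde_op k A) \<longleftrightarrow> bounded_below_by \<alpha> U \<D> A"
  by (simp add: bounded_below_by_def tilde_dom_eq_image tilde_op_def phase_minus_cancel l2_norm_phase)

lemma bounded_below_tilde:
  "bounded_below U (tilde_dom k \<D>) (tilde_op k A) \<longleftrightarrow> bounded_below U \<D> A"
  by (simp add: bounded_below_def bounded_below_by_tilde)

theorem lemma2p2:
  shows "(\<forall>(D :: (real^'d) set) L \<omega> a lam \<phi> k.
      acoustic_setting D L \<omega> a lam \<phi> \<longrightarrow>
      (bounded_below (waveguide D L) (tilde_dom k (dom_helm D L \<omega> lam \<phi>)) (tilde_op k (A_helm D L \<omega> a))
        \<longleftrightarrow> bounded_below (waveguide D L) (dom_helm D L \<omega> lam \<phi>) (A_helm D L \<omega> a)) \<and>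
      (\<forall>\<alpha>>0.
        bounded_below_by \<alpha> (waveguide D L) (dom_helm D L \<omega> lam \<phi>) (A_helm D L \<omega> a)
        \<longleftrightarrow> bounded_below_by \<alpha> (waveguide D L) (tilde_dom k (dom_helm D L \<omega> lam \<phi>))
              (tilde_op k (A_helm D L \<omega> a)))) \<and>
    (\<forall>(D :: (real^2) set) L \<omega> lam \<phi> mu \<psi> k.
      maxwell_setting D L \<omega> lam \<phi> mu \<psi> \<longrightarrow>
      (bounded_below (waveguide D L) (tilde_dom k (dom_mw D L \<omega> lam \<phi> mu \<psi>)) (tilde_op k (A_mw D L \<omega>))
        \<longleftrightarrow> bounded_below (waveguide D L) (dom_mw D L \<omega> lam \<phi> mu \<psi>) (A_mw D L \<omega>)) \<and>
      (\<forall>\<alpha>>0.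
        bounded_below_by \<alpha> (waveguide D L) (dom_mw D L \<omega> lam \<phi> mu \<psi>) (A_mw D L \<omega>)
        \<longleftrightarrow> bounded_below_by \<alpha> (waveguide D L) (tilde_dom k (dom_mw D L \<omega> lam \<phi> mu \<psi>))
              (tilde_op k (A_mw D L \<omega>))))"
  by (simp add: bounded_below_by_tilde bounded_below_tilde)

end
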